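(* Let $A$ be a commutative differential algebra over $\mathbb{F}_2$, let $n\ge 2$ and let $a_1,\dots,a_n\in HA$. Then the decompositions of zero $0\in\langle a_1,\dots,a_n\rangle$ as an $n$-fold Massey product, together with a defining system, are in one-to-one correspondence with the maps of differential algebras $f:X_n\to A$ whose induced map $f_*:HX_n\to HA$ satisfies $f_*(h_{i-1})=a_i$ for $1\le i\le n$.
   Context: A commutative differential algebra $A$ over $\mathbb F_2$ is a unital commutative $\mathbb F_2$-algebra with an $\mathbb F_2$-linear derivation $d$ with $d^2=0$; $HA=\ker d/\operatorname{im} d$. Maps of differential algebras are unital algebra homomorphisms commuting with $d$ (no grading is required to be preserved). $X_n=\mathbb{F}_2[R_{ij}: 0\le i<j\le n]$ with derivation $dR_{ij}=\sum_{k=i+1}^{j-1}R_{ik}R_{kj}$; $h_{i-1}\in HX_n$ is the homology class of $R_{i-1,i}$. For $a_1,\dots,a_n\in HA$, a defining system for the Massey product $\langle a_1,\dots,a_n\rangle$ is a family $a_{ij}\in A$, for $0\le i<j\le n$ and $(i,j)\ne(0,n)$, such that $a_{i-1,i}$ is a cycle representing $a_i$ and $da_{ij}=\sum_{k=i+1}^{j-1}a_{ik}a_{kj}$ for all such $(i,j)$. The class of the cycle $\sum_{k=1}^{n-1}a_{0k}a_{kn}$ is the element of $\langle a_1,\dots,a_n\rangle$ given by the defining system. A decomposition of zero $0\in\langle a_1,\dots,a_n\rangle$ together with a defining system means a defining system $(a_{ij})$ together with an element $a_{0n}\in A$ with $da_{0n}=\sum_{k=1}^{n-1}a_{0k}a_{kn}$.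 *)

theory Defs
  imports
    "HOL-Algebra.QuotRing"
    "HOL-Algebra.Module"
    "HOL-Library.Z2"
    "HOL-Library.Poly_Mapping"
begin

section \<open>Commutative differential algebras over the field with two elements\<close>

definition F2 :: "bit ring"
  where "F2 = \<lparr>carrier = UNIV, mult = (*), one = 1, zero = 0, add = (+)\<rparr>"

record ('k, 'a) diff_algebra = "('k, 'a) module" +
  diff :: "'a \<Rightarrow> 'a"

text \<open>No assumption \<open>\<one> \<noteq> \<zero>\<close> is made, so the zero algebra is included.\<close>

locale comm_diff_algebra = algebra F2 A for A :: "(bit, 'a) diff_algebra" (structure) +
  assumes diff_closed: "x \<in> carrier A \<Longrightarrow> diff A x \<in> carrier A"
    and diff_add: "\<lbrakk>x \<in> carrier A; y \<in> carrier A\<rbrakk> \<Longrightarrow> diff A (x \<oplus> y) = diff A x \<oplus> diff A y"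
    and diff_smult: "x \<in> carrier A \<Longrightarrow> diff A (c \<odot> x) = c \<odot> diff A x"
    and diff_mult: "\<lbrakk>x \<in> carrier A; y \<in> carrier A\<rbrakk> \<Longrightarrow>
          diff A (x \<otimes> y) = diff A x \<otimes> y \<oplus> x \<otimes> diff A y"
    and diff_diff: "x \<in> carrier A \<Longrightarrow> diff A (diff A x) = \<zero>"

definition cycles :: "(bit, 'a) diff_algebra \<Rightarrow> 'a set"
  where "cycles A = {z \<in> carrier A. diff A z = \<zero>\<^bsub>A\<^esub>}"

definition boundaries :: "(bit, 'a) diff_algebra \<Rightarrow> 'a set"
  where "boundaries A = diff A ` carrier A"

text \<open>Homology classes are the cosets of the boundaries in the ring of cycles.\<close>

definition homology :: "(bit, 'a) diff_algebra \<Rightarrow> 'a set ring"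
  where "homology A = (A\<lparr>carrier := cycles A\<rparr>) Quot (boundaries A)"

definition homology_class :: "(bit, 'a) diff_algebra \<Rightarrow> 'a \<Rightarrow> 'a set"
  where "homology_class A z = boundaries A +>\<^bsub>A\<^esub> z"

text \<open>Maps are extensional (\<open>undefined\<close> outside the carrier), so that two of them are equal
  as HOL functions exactly when they agree on the carrier. Preservation of \<open>\<one>\<close> is part
  of \<^const>\<open>ring_hom\<close>.\<close>

definition diff_algebra_maps ::
    "(bit, 'a) diff_algebra \<Rightarrow> (bit, 'b) diff_algebra \<Rightarrow> ('a \<Rightarrow> 'b) set"
  where "diff_algebra_maps A B =
    {f \<in> carrier A \<rightarrow>\<^sub>E carrier B. f \<in> ring_hom A B \<and>
       (\<forall>c. \<forall>x\<in>carrier A. f (c \<odot>\<^bsub>A\<^esub> x) = c \<odot>\<^bsub>B\<^esub> f x) \<and>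
       (\<forall>x\<in>carrier A. f (diff A x) = diff B (f x))}"

text \<open>The common value of \<open>homology_class B (f z)\<close> for all representatives \<open>z\<close> of the class
  \<open>C\<close>; it is well defined when \<open>f\<close> is a map of differential algebras.\<close>

definition induced_map ::
    "(bit, 'a) diff_algebra \<Rightarrow> (bit, 'b) diff_algebra \<Rightarrow> ('a \<Rightarrow> 'b) \<Rightarrow> 'a set \<Rightarrow> 'b set"
  where "induced_map A B f C = the_elem ((\<lambda>z. homology_class B (f z)) ` C)"


section \<open>Defining systems and decompositions of zero\<close>

definition massey_index :: "nat \<Rightarrow> (nat \<times> nat) set"
  where "massey_index n = {(i, j). i < j \<and> j \<le> n}"

definition massey_sum :: "(bit, 'a) diff_algebra \<Rightarrow> (nat \<times> nat \<Rightarrow> 'a) \<Rightarrow> nat \<Rightarrow> nat \<Rightarrow> 'a"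
  where "massey_sum A a i j = (\<Oplus>\<^bsub>A\<^esub>k\<in>{i<..<j}. a (i, k) \<otimes>\<^bsub>A\<^esub> a (k, j))"

text \<open>The homology classes are indexed from 1 to \<open>n\<close> and given by a function on \<open>nat\<close>; its
  other values play no role. Families are extensional, for the same reason as maps.\<close>

definition defining_systems ::
    "(bit, 'a) diff_algebra \<Rightarrow> nat \<Rightarrow> (nat \<Rightarrow> 'a set) \<Rightarrow> (nat \<times> nat \<Rightarrow> 'a) set"
  where "defining_systems A n \<alpha> =
    {a \<in> (massey_index n - {(0, n)}) \<rightarrow>\<^sub>E carrier A.
       (\<forall>i\<in>{1..n}. a (i - 1, i) \<in> cycles A \<and> homology_class A (a (i - 1, i)) = \<alpha> i) \<and>
       (\<forall>(i, j)\<in>massey_index n - {(0, n)}. diff A (a (i, j)) = massey_sum A a i j)}"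

definition zero_decompositions ::
    "(bit, 'a) diff_algebra \<Rightarrow> nat \<Rightarrow> (nat \<Rightarrow> 'a set) \<Rightarrow> ((nat \<times> nat \<Rightarrow> 'a) \<times> 'a) set"
  where "zero_decompositions A n \<alpha> =
    {(a, b). a \<in> defining_systems A n \<alpha> \<and> b \<in> carrier A \<and> diff A b = massey_sum A a 0 n}"


section \<open>The universal algebra\<close>

text \<open>Polynomials over \<open>F2\<close> in variables indexed by \<open>nat \<times> nat\<close>: finitely supported
  coefficient functions on monomials, which are finitely supported exponent functions.\<close>

type_synonym massey_monom = "nat \<times> nat \<Rightarrow>\<^sub>0 nat"
type_synonym massey_poly = "massey_monom \<Rightarrow>\<^sub>0 bit"

definition massey_var :: "nat \<Rightarrow> nat \<Rightarrow> massey_poly"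
  where "massey_var i j = Poly_Mapping.single (Poly_Mapping.single (i, j) 1) 1"

definition massey_const :: "bit \<Rightarrow> massey_poly"
  where "massey_const c = Poly_Mapping.single 0 c"

definition massey_var_diff :: "nat \<times> nat \<Rightarrow> massey_poly"
  where "massey_var_diff = (\<lambda>(i, j). \<Sum>k\<in>{i<..<j}. massey_var i k * massey_var k j)"

text \<open>The linear derivation extending \<^const>\<open>massey_var_diff\<close>, i.e. the sum over all variables
  \<open>v\<close> of the partial derivative by \<open>v\<close> times \<open>massey_var_diff v\<close>.\<close>

definition massey_monom_diff :: "massey_monom \<Rightarrow> massey_poly"
  where "massey_monom_diff m =
    (\<Sum>v\<in>Poly_Mapping.keys m. massey_const (of_nat (Poly_Mapping.lookup m v)) *
       Poly_Mapping.single (m - Poly_Mapping.single v 1) 1 * massey_var_diff v)"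

definition massey_diff :: "massey_poly \<Rightarrow> massey_poly"
  where "massey_diff p =
    (\<Sum>m\<in>Poly_Mapping.keys p. massey_const (Poly_Mapping.lookup p m) * massey_monom_diff m)"

definition massey_alg :: "nat \<Rightarrow> (bit, massey_poly) diff_algebra"
  where "massey_alg n =
    \<lparr>carrier = {p. \<forall>m\<in>Poly_Mapping.keys p. Poly_Mapping.keys m \<subseteq> massey_index n},
     mult = (*), one = 1, zero = 0, add = (+),
     smult = (\<lambda>c p. massey_const c * p), diff = massey_diff\<rparr>"

definition massey_h :: "nat \<Rightarrow> nat \<Rightarrow> massey_poly set"
  where "massey_h n i = homology_class (massey_alg n) (massey_var i (i + 1))"


subsection \<open>The universal algebra is a commutative differential algebra\<close>

declare add_bit_eq_xor [simp del] mult_bit_eq_and [simp del]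

lemma massey_const_simps [simp]:
  "massey_const 0 = 0" "massey_const 1 = 1"
  "massey_const (c + c') = massey_const c + massey_const c'"
  "massey_const (c * c') = massey_const c * massey_const c'"
  by (simp_all add: massey_const_def single_add mult_single)

lemma massey_diff_superset:
  assumes "finite S" "Poly_Mapping.keys p \<subseteq> S"
  shows "massey_diff p = (\<Sum>m\<in>S. massey_const (Poly_Mapping.lookup p m) * massey_monom_diff m)"
  unfolding massey_diff_def
  by (rule sum.mono_neutral_left) (use assms in \<open>auto simp: in_keys_iff\<close>)

lemma massey_diff_add: "massey_diff (p + q) = massey_diff p + massey_diff q"
proof -
  let ?S = "Poly_Mapping.keys p \<union> Poly_Mapping.keys q"
  have "Poly_Mapping.keys (p + q) \<subseteq> ?S" by (rule Poly_Mapping.keys_add)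
  then show ?thesis
    by (simp add: massey_diff_superset[of ?S] lookup_add distrib_right sum.distrib)
qed

lemma massey_diff_0 [simp]: "massey_diff 0 = 0"
  by (simp add: massey_diff_def)

lemma massey_diff_sum: "massey_diff (sum f S) = (\<Sum>x\<in>S. massey_diff (f x))"
  by (induction S rule: infinite_finite_induct) (simp_all add: massey_diff_add)

lemma massey_diff_single:
  "massey_diff (Poly_Mapping.single m c) = massey_const c * massey_monom_diff m"
  by (subst massey_diff_superset[of "{m}"]) auto

lemma massey_poly_expand:
  "p = (\<Sum>m\<in>Poly_Mapping.keys p. Poly_Mapping.single m (Poly_Mapping.lookup p m))"
  by (rule poly_mapping_eqI)
    (auto simp: lookup_sum lookup_single when_def in_keys_iff)

lemma massey_monom_diff_superset:
  assumes "finite S" "Poly_Mapping.keys m \<subseteq> S"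
  shows "massey_monom_diff m = (\<Sum>v\<in>S. massey_const (of_nat (Poly_Mapping.lookup m v)) *
       Poly_Mapping.single (m - Poly_Mapping.single v 1) 1 * massey_var_diff v)"
  unfolding massey_monom_diff_def
  by (rule sum.mono_neutral_left) (use assms in \<open>auto simp: in_keys_iff\<close>)

lemma massey_partial_shift:
  "massey_const (of_nat (Poly_Mapping.lookup m v)) *
      Poly_Mapping.single (m + m' - Poly_Mapping.single v 1) 1 =
   massey_const (of_nat (Poly_Mapping.lookup m v)) *
      Poly_Mapping.single (m - Poly_Mapping.single v 1) 1 * Poly_Mapping.single m' 1"
proof (cases "Poly_Mapping.lookup m v = 0")
  case False
  then have "m + m' - Poly_Mapping.single v 1 = (m - Poly_Mapping.single v 1) + m'"
    by (intro poly_mapping_eqI) (auto simp: lookup_add lookup_minus lookup_single when_def)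
  then show ?thesis by (simp add: mult_single mult.assoc)
qed simp

lemma massey_monom_diff_add:
  "massey_monom_diff (m + m') =
     massey_monom_diff m * Poly_Mapping.single m' 1 + Poly_Mapping.single m 1 * massey_monom_diff m'"
proof -
  let ?S = "Poly_Mapping.keys m \<union> Poly_Mapping.keys m'"
  let ?c = "\<lambda>m v. massey_const (of_nat (Poly_Mapping.lookup m v))"
  let ?s = "\<lambda>m v. Poly_Mapping.single (m - Poly_Mapping.single v 1) (1::bit)"
  have "massey_monom_diff (m + m') = (\<Sum>v\<in>?S. ?c (m + m') v * ?s (m + m') v * massey_var_diff v)"
    by (rule massey_monom_diff_superset) (auto simp: Poly_Mapping.keys_add)
  also have "\<dots> = (\<Sum>v\<in>?S. ?c m v * ?s m v * Poly_Mapping.single m' 1 * massey_var_diff v +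
      ?c m' v * ?s m' v * Poly_Mapping.single m 1 * massey_var_diff v)"
    using massey_partial_shift[of m _ m'] massey_partial_shift[of m' _ m]
    by (simp add: lookup_add distrib_right add.commute[of m'])
  finally show ?thesis
    by (simp add: massey_monom_diff_superset[of ?S] sum.distrib sum_distrib_left sum_distrib_right
        mult.assoc mult.commute mult.left_commute)
qed

lemma massey_single_expand:
  "Poly_Mapping.single m c = massey_const c * Poly_Mapping.single m 1"
  by (simp add: massey_const_def mult_single)

lemma massey_diff_mult: "massey_diff (p * q) = massey_diff p * q + p * massey_diff q"
proof -
  have *: "massey_diff (Poly_Mapping.single m c * Poly_Mapping.single m' c') =
      massey_diff (Poly_Mapping.single m c) * Poly_Mapping.single m' c' +
      Poly_Mapping.single m c * massey_diff (Poly_Mapping.single m' c')" for m m' c c'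
    unfolding mult_single massey_diff_single massey_monom_diff_add
    by (subst (2) massey_single_expand, subst (3) massey_single_expand)
      (simp add: algebra_simps)
  have **: "massey_diff (Poly_Mapping.single m c * q) =
      massey_diff (Poly_Mapping.single m c) * q + Poly_Mapping.single m c * massey_diff q" for m c
    by (subst (1 2 3) massey_poly_expand[of q])
      (simp add: sum_distrib_left massey_diff_sum * sum.distrib)
  show ?thesis
    by (subst (1 2 3) massey_poly_expand[of p])
      (simp add: sum_distrib_right massey_diff_sum ** sum.distrib)
qed

lemma massey_diff_const: "massey_diff (massey_const c) = 0"
  unfolding massey_const_def massey_diff_single by (simp add: massey_monom_diff_def)

lemma massey_diff_const_mult: "massey_diff (massey_const c * p) = massey_const c * massey_diff p"
  by (simp add: massey_diff_mult massey_diff_const)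

lemma massey_diff_var:
  "massey_diff (massey_var i j) = (\<Sum>k\<in>{i<..<j}. massey_var i k * massey_var k j)"
  unfolding massey_var_def massey_diff_single
  by (simp add: massey_monom_diff_def massey_var_diff_def massey_var_def)

lemma massey_poly_double [simp]: "p + p = (0 :: massey_poly)"
proof (rule poly_mapping_eqI)
  fix m
  have "c + c = 0" for c :: bit by (cases c) simp_all
  then show "Poly_Mapping.lookup (p + p) m = Poly_Mapping.lookup 0 m"
    by (simp only: lookup_add lookup_zero)
qed

lemma massey_diff_diff_var: "massey_diff (massey_diff (massey_var i j)) = 0"
proof -
  let ?t = "\<lambda>l k. massey_var i l * massey_var l k * massey_var k j"
  have "massey_diff (massey_diff (massey_var i j)) =
      (\<Sum>k\<in>{i<..<j}. \<Sum>l\<in>{i<..<k}. ?t l k) + (\<Sum>k\<in>{i<..<j}. \<Sum>l\<in>{k<..<j}. ?t k l)"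
    by (simp add: massey_diff_var massey_diff_sum massey_diff_mult sum.distrib
        sum_distrib_left sum_distrib_right mult.assoc)
  also have "(\<Sum>k\<in>{i<..<j}. \<Sum>l\<in>{k<..<j}. ?t k l) = (\<Sum>k\<in>{i<..<j}. \<Sum>l\<in>{i<..<k}. ?t l k)"
    unfolding sum.Sigma[OF finite_greaterThanLessThan ballI[OF finite_greaterThanLessThan]]
    by (rule sum.reindex_bij_witness[of _ "\<lambda>(k, l). (l, k)" "\<lambda>(k, l). (l, k)"]) auto
  finally show ?thesis by simp
qed

lemma massey_diff_diff: "massey_diff (massey_diff p) = 0"
proof -
  let ?D = "\<lambda>p. massey_diff (massey_diff p)"
  have mult: "?D (p * q) = ?D p * q + p * ?D q" for p q
    using massey_poly_double[of "massey_diff p * massey_diff q"]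
    by (simp only: massey_diff_mult massey_diff_add)
      (simp only: ac_simps add_0_left add_0_right flip: add.assoc)
  have pow: "?D (Poly_Mapping.single (Poly_Mapping.single v k) 1) = 0" for v k
  proof (induction k)
    case 0
    show ?case using massey_diff_const[of 1] by simp
  next
    case (Suc k)
    have "Poly_Mapping.single (Poly_Mapping.single v (Suc k)) (1::bit) =
        massey_var (fst v) (snd v) * Poly_Mapping.single (Poly_Mapping.single v k) 1"
      by (simp add: massey_var_def mult_single flip: single_add)
    then show ?case by (simp add: mult Suc massey_diff_diff_var)
  qed
  have monom: "?D (Poly_Mapping.single m 1) = 0" for m
  proof (induction m rule: update_induct)
    case const
    show ?case using massey_diff_const[of 1] by simp
  next
    case (update m v k)
    have "Poly_Mapping.update v k m = m + Poly_Mapping.single v k"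
      by (rule poly_mapping_eqI)
        (use update in \<open>auto simp: lookup_update lookup_add lookup_single when_def in_keys_iff\<close>)
    then have "Poly_Mapping.single (Poly_Mapping.update v k m) (1::bit) =
        Poly_Mapping.single m 1 * Poly_Mapping.single (Poly_Mapping.single v k) 1"
      by (simp add: mult_single)
    then show ?case using update pow by (simp add: mult)
  qed
  have "?D (Poly_Mapping.single m c) = 0" for m c
    by (subst massey_single_expand) (simp add: massey_diff_const_mult monom)
  then show ?thesis
    by (subst massey_poly_expand) (simp add: massey_diff_sum)
qed

lemma massey_carrier_iff:
  "p \<in> carrier (massey_alg n) \<longleftrightarrow>
     (\<forall>m\<in>Poly_Mapping.keys p. Poly_Mapping.keys m \<subseteq> massey_index n)"
  by (simp add: massey_alg_def)

lemma massey_alg_simps [simp]: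
  "mult (massey_alg n) = (*)" "one (massey_alg n) = 1" "zero (massey_alg n) = 0"
  "add (massey_alg n) = (+)" "smult (massey_alg n) = (\<lambda>c p. massey_const c * p)"
  "diff (massey_alg n) = massey_diff"
  by (simp_all add: massey_alg_def)

lemma massey_carrier_0: "0 \<in> carrier (massey_alg n)"
  by (simp add: massey_carrier_iff)

lemma massey_carrier_const: "massey_const c \<in> carrier (massey_alg n)"
  by (auto simp: massey_carrier_iff massey_const_def split: if_splits)

lemma massey_carrier_1: "1 \<in> carrier (massey_alg n)"
  using massey_carrier_const[of 1] by simp

lemma massey_carrier_add:
  "\<lbrakk>p \<in> carrier (massey_alg n); q \<in> carrier (massey_alg n)\<rbrakk> \<Longrightarrow> p + q \<in> carrier (massey_alg n)"
  using Poly_Mapping.keys_add[of p q] unfolding massey_carrier_iff by blast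

lemma massey_carrier_mult:
  assumes "p \<in> carrier (massey_alg n)" "q \<in> carrier (massey_alg n)"
  shows "p * q \<in> carrier (massey_alg n)"
  unfolding massey_carrier_iff
proof
  fix m assume "m \<in> Poly_Mapping.keys (p * q)"
  then obtain a b where "m = a + b" "a \<in> Poly_Mapping.keys p" "b \<in> Poly_Mapping.keys q"
    using Poly_Mapping.keys_mult[of p q] by blast
  then show "Poly_Mapping.keys m \<subseteq> massey_index n"
    using assms Poly_Mapping.keys_add[of a b] unfolding massey_carrier_iff by blast
qed

lemma massey_carrier_sum:
  "(\<And>x. x \<in> S \<Longrightarrow> f x \<in> carrier (massey_alg n)) \<Longrightarrow> sum f S \<in> carrier (massey_alg n)"
  by (induction S rule: infinite_finite_induct) (simp_all add: massey_carrier_0 massey_carrier_add)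

lemma massey_carrier_var:
  "(i, j) \<in> massey_index n \<Longrightarrow> massey_var i j \<in> carrier (massey_alg n)"
  by (simp add: massey_carrier_iff massey_var_def)

lemma massey_carrier_diff:
  assumes "p \<in> carrier (massey_alg n)"
  shows "massey_diff p \<in> carrier (massey_alg n)"
  unfolding massey_diff_def massey_monom_diff_def
proof (intro massey_carrier_sum massey_carrier_mult massey_carrier_const)
  fix m v assume m: "m \<in> Poly_Mapping.keys p" and v: "v \<in> Poly_Mapping.keys m"
  have sub: "Poly_Mapping.keys m \<subseteq> massey_index n"
    using assms m by (simp add: massey_carrier_iff)
  have "Poly_Mapping.keys (m - Poly_Mapping.single v 1) \<subseteq> Poly_Mapping.keys m"
    by (auto simp: in_keys_iff lookup_minus)
  then show "Poly_Mapping.single (m - Poly_Mapping.single v 1) 1 \<in> carrier (massey_alg n)"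
    using sub by (auto simp: massey_carrier_iff)
  obtain i j where ij: "v = (i, j)" by (cases v)
  have "(i, j) \<in> massey_index n" using sub v ij by auto
  then show "massey_var_diff v \<in> carrier (massey_alg n)"
    unfolding massey_var_diff_def ij prod.case
    by (intro massey_carrier_sum massey_carrier_mult massey_carrier_var)
      (auto simp: massey_index_def)
qed

lemma F2_cring: "cring F2"
  by (unfold_locales)
    (auto simp: F2_def Units_def algebra_simps intro: add.right_inverse)

lemma massey_alg_cring: "cring (massey_alg n)"
proof (rule cringI)
  show "abelian_group (massey_alg n)"
    by (rule abelian_groupI)
      (auto simp: massey_carrier_0 massey_carrier_add ac_simps intro: massey_poly_double)
  show "comm_monoid (massey_alg n)"
    by (rule comm_monoidI) (auto simp: massey_carrier_1 massey_carrier_mult algebra_simps)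
qed (auto simp: algebra_simps)

lemma massey_alg_algebra: "algebra F2 (massey_alg n)"
  by (rule algebraI[OF F2_cring massey_alg_cring])
    (auto simp: massey_carrier_mult massey_carrier_const F2_def algebra_simps)

lemma massey_alg_comm_diff_algebra: "comm_diff_algebra (massey_alg n)"
  by (intro comm_diff_algebra.intro comm_diff_algebra_axioms.intro massey_alg_algebra)
    (auto simp: massey_carrier_diff massey_diff_add massey_diff_const massey_diff_mult
      massey_diff_diff)

end

theory Submission
  imports Defs
begin

text \<open>The algebra \<open>X\<^sub>n\<close> is free as a commutative algebra on the variables \<open>R\<^sub>i\<^sub>j\<close>, so an algebra
  homomorphism out of it is the same thing as a family \<open>b\<^sub>i\<^sub>j\<close> of elements of \<open>A\<close>. Compatibility
  with the derivations need only be tested on the variables, because both composites satisfy the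
  same Leibniz rule over the homomorphism. On \<open>R\<^sub>i\<^sub>j\<close> it reads \<open>d b\<^sub>i\<^sub>j = \<Sum>\<^sub>k b\<^sub>i\<^sub>k b\<^sub>k\<^sub>j\<close>. For
  \<open>(i, j) \<noteq> (0, n)\<close> these are the equations of a defining system, and for \<open>(0, n)\<close> the equation
  says that \<open>b\<^sub>0\<^sub>n\<close> bounds the cycle of that system. The condition on homology says that the entry
  at \<open>(i - 1, i)\<close> represents the \<open>i\<close>-th class.

  The freeness consists of \<open>poly_eval_map\<close> (existence, by evaluation at the family) and
  \<open>massey_map_eqI\<close> (uniqueness). Necessity of the equations is \<open>massey_map_diff_var\<close>, and
  \<open>induced_map_massey_h\<close> translates the condition on homology.\<close>

section \<open>Induction over polynomials\<close>

text \<open>This serves identities between additive functions of all polynomials, such as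
  multiplicativity of evaluation, which can be read off from single terms.\<close>

lemma massey_poly_additive_induct [case_names single add]:
  assumes "\<And>m c. P (Poly_Mapping.single m c)"
    and "\<And>p q. P p \<Longrightarrow> P q \<Longrightarrow> P (p + q)"
  shows "P (p :: massey_poly)"
proof -
  have "P (\<Sum>m\<in>S. Poly_Mapping.single m (Poly_Mapping.lookup p m))" for S
  proof (induction S rule: infinite_finite_induct)
    case (insert m S)
    then show ?case using assms by simp
  qed (use assms(1)[of 0 0] in simp_all)
  then show ?thesis by (subst massey_poly_expand)
qed

text \<open>The constants and the variables generate the algebra. This carries both the uniqueness of
  maps and the reduction of their compatibility with the derivations to variables.\<close>

lemma massey_alg_induct [consumes 1, case_names const var add mult]:
  assumes p: "p \<in> carrier (massey_alg n)"
    and const: "\<And>c. P (massey_const c)"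
    and var: "\<And>i j. (i, j) \<in> massey_index n \<Longrightarrow> P (massey_var i j)"
    and add: "\<And>p q. \<lbrakk>p \<in> carrier (massey_alg n); q \<in> carrier (massey_alg n); P p; P q\<rbrakk> \<Longrightarrow> P (p + q)"
    and mult: "\<And>p q. \<lbrakk>p \<in> carrier (massey_alg n); q \<in> carrier (massey_alg n); P p; P q\<rbrakk> \<Longrightarrow> P (p * q)"
  shows "P p"
proof -
  (* The closure steps require membership in the carrier, so it is carried along with P. *)
  let ?Q = "\<lambda>p. p \<in> carrier (massey_alg n) \<and> P p"
  have Q_const: "?Q (massey_const c)" for c
    by (simp add: massey_carrier_const const)
  have Q_mult: "?Q (p * q)" if "?Q p" "?Q q" for p q
    using that by (simp add: massey_carrier_mult mult)
  have pow: "?Q (Poly_Mapping.single (Poly_Mapping.single v k) 1)" if "v \<in> massey_index n" for v k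
  proof (induction k)
    case 0
    show ?case using Q_const[of 1] by simp
  next
    case (Suc k)
    have "Poly_Mapping.single (Poly_Mapping.single v (Suc k)) (1::bit) =
        massey_var (fst v) (snd v) * Poly_Mapping.single (Poly_Mapping.single v k) 1"
      by (simp add: massey_var_def mult_single flip: single_add)
    moreover have "?Q (massey_var (fst v) (snd v))"
      using that by (simp add: massey_carrier_var var)
    ultimately show ?case using Suc Q_mult by metis
  qed
  have monom: "Poly_Mapping.keys m \<subseteq> massey_index n \<Longrightarrow> ?Q (Poly_Mapping.single m 1)" for m
  proof (induction m rule: update_induct)
    case const
    show ?case using Q_const[of 1] by simp
  next
    case (update m v k)
    have eq: "Poly_Mapping.update v k m = m + Poly_Mapping.single v k"
      by (rule poly_mapping_eqI)
        (use update in \<open>auto simp: lookup_update lookup_add lookup_single when_def in_keys_iff\<close>)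
    have sub: "v \<in> massey_index n" "Poly_Mapping.keys m \<subseteq> massey_index n"
      using update by (auto simp: keys_update split: if_splits)
    have "Poly_Mapping.single (Poly_Mapping.update v k m) (1::bit) =
        Poly_Mapping.single m 1 * Poly_Mapping.single (Poly_Mapping.single v k) 1"
      by (simp add: eq mult_single)
    then show ?case using update.IH[OF sub(2)] pow[OF sub(1), of k] Q_mult by metis
  qed
  have "S \<subseteq> Poly_Mapping.keys p \<Longrightarrow>
      ?Q (\<Sum>m\<in>S. Poly_Mapping.single m (Poly_Mapping.lookup p m))" for S
  proof (induction S rule: infinite_finite_induct)
    case (insert m S)
    have "Poly_Mapping.keys m \<subseteq> massey_index n"
      using insert.prems p by (auto simp: massey_carrier_iff)
    then have "?Q (massey_const (Poly_Mapping.lookup p m) * Poly_Mapping.single m 1)"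
      using monom Q_const Q_mult by blast
    then have "?Q (Poly_Mapping.single m (Poly_Mapping.lookup p m))"
      by (metis massey_single_expand)
    moreover have "?Q (\<Sum>m\<in>S. Poly_Mapping.single m (Poly_Mapping.lookup p m))"
      using insert by blast
    ultimately show ?case using insert.hyps by (simp add: massey_carrier_add add)
  qed (use Q_const[of 0] in simp_all)
  then show ?thesis by (subst massey_poly_expand) blast
qed


section \<open>Evaluating polynomials in a commutative differential algebra\<close>

definition monom_eval :: "(bit, 'a) diff_algebra \<Rightarrow> (nat \<times> nat \<Rightarrow> 'a) \<Rightarrow> massey_monom \<Rightarrow> 'a"
  where "monom_eval A b m =
    (\<Otimes>\<^bsub>A\<^esub>v\<in>Poly_Mapping.keys m. b v [^]\<^bsub>A\<^esub> Poly_Mapping.lookup m v)"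

definition poly_eval :: "(bit, 'a) diff_algebra \<Rightarrow> (nat \<times> nat \<Rightarrow> 'a) \<Rightarrow> massey_poly \<Rightarrow> 'a"
  where "poly_eval A b p =
    (\<Oplus>\<^bsub>A\<^esub>m\<in>Poly_Mapping.keys p. Poly_Mapping.lookup p m \<odot>\<^bsub>A\<^esub> monom_eval A b m)"

lemma F2_simps [simp]:
  "carrier F2 = UNIV" "mult F2 = (*)" "add F2 = (+)" "zero F2 = 0" "one F2 = 1"
  by (simp_all add: F2_def)

context comm_diff_algebra
begin

lemma F2_smult:
  assumes "x \<in> carrier A"
  shows "c \<odot> x \<in> carrier A" "0 \<odot> x = \<zero>" "1 \<odot> x = x"
    "(c + c') \<odot> x = c \<odot> x \<oplus> c' \<odot> x" "(c * c') \<odot> x = c \<odot> (c' \<odot> x)"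
  using assms smult_l_null[of x] smult_one[of x] smult_l_distr[of c c' x] smult_assoc1[of c c' x]
    smult_closed[of c x] by simp_all

lemma F2_smult_mult:
  assumes "x \<in> carrier A" "y \<in> carrier A"
  shows "(c \<odot> x) \<otimes> y = c \<odot> (x \<otimes> y)" "x \<otimes> (c \<odot> y) = c \<odot> (x \<otimes> y)"
  using assms smult_assoc2[of c x y] smult_assoc2[of c y x] F2_smult(1)[of _ c]
  by (simp_all add: m_comm)

lemma diff_one: "diff A \<one> = \<zero>"
proof -
  have c: "diff A \<one> \<in> carrier A" by (simp add: diff_closed)
  have "diff A \<one> \<oplus> diff A \<one> = diff A \<one>"
    using diff_mult[of \<one> \<one>] c by simp
  then show ?thesis using c by (metis add.l_cancel_one)
qed

text \<open>The family is required to lie in \<open>A\<close> at all pairs of indices, also outside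
  \<^const>\<open>massey_index\<close>. Evaluation is then a homomorphism on all polynomials, so that it can be
  computed term by term; only the derivation depends on the index set.\<close>

context
  fixes b :: "nat \<times> nat \<Rightarrow> 'a"
  assumes b: "\<And>v. b v \<in> carrier A"
begin

lemma monom_eval_closed [simp]: "monom_eval A b m \<in> carrier A"
  unfolding monom_eval_def by (rule finprod_closed) (simp add: b)

lemma poly_eval_closed [simp]: "poly_eval A b p \<in> carrier A"
  unfolding poly_eval_def by (rule finsum_closed) (simp add: F2_smult)

text \<open>Summing over any finite superset of the support lets two monomials or polynomials be
  compared over the union of their supports.\<close>

lemma monom_eval_superset:
  assumes "finite S" "Poly_Mapping.keys m \<subseteq> S"
  shows "monom_eval A b m = (\<Otimes>v\<in>S. b v [^] Poly_Mapping.lookup m v)"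
  unfolding monom_eval_def
  by (rule finprod_mono_neutral_cong_left) (use assms b in \<open>auto simp: in_keys_iff\<close>)

lemma poly_eval_superset:
  assumes "finite S" "Poly_Mapping.keys p \<subseteq> S"
  shows "poly_eval A b p = (\<Oplus>m\<in>S. Poly_Mapping.lookup p m \<odot> monom_eval A b m)"
  unfolding poly_eval_def
  by (rule add.finprod_mono_neutral_cong_left) (use assms in \<open>auto simp: in_keys_iff F2_smult\<close>)

lemma monom_eval_add: "monom_eval A b (m + m') = monom_eval A b m \<otimes> monom_eval A b m'"
proof -
  let ?S = "Poly_Mapping.keys m \<union> Poly_Mapping.keys m'"
  have "monom_eval A b (m + m') = (\<Otimes>v\<in>?S. b v [^] Poly_Mapping.lookup (m + m') v)"
    by (rule monom_eval_superset) (auto simp: Poly_Mapping.keys_add)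
  also have "\<dots> = (\<Otimes>v\<in>?S. b v [^] Poly_Mapping.lookup m v \<otimes> b v [^] Poly_Mapping.lookup m' v)"
    by (simp add: lookup_add nat_pow_mult b)
  also have "\<dots> = (\<Otimes>v\<in>?S. b v [^] Poly_Mapping.lookup m v) \<otimes>
      (\<Otimes>v\<in>?S. b v [^] Poly_Mapping.lookup m' v)"
    by (rule finprod_multf) (simp_all add: b)
  finally show ?thesis by (simp add: monom_eval_superset[of ?S])
qed

lemma poly_eval_add: "poly_eval A b (p + q) = poly_eval A b p \<oplus> poly_eval A b q"
proof -
  let ?S = "Poly_Mapping.keys p \<union> Poly_Mapping.keys q"
  let ?t = "\<lambda>p m. Poly_Mapping.lookup p m \<odot> monom_eval A b m"
  have "poly_eval A b (p + q) = (\<Oplus>m\<in>?S. ?t (p + q) m)"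
    by (rule poly_eval_superset) (auto simp: Poly_Mapping.keys_add)
  also have "\<dots> = (\<Oplus>m\<in>?S. ?t p m \<oplus> ?t q m)"
    by (simp add: lookup_add F2_smult)
  also have "\<dots> = (\<Oplus>m\<in>?S. ?t p m) \<oplus> (\<Oplus>m\<in>?S. ?t q m)"
    by (rule finsum_addf) (simp_all add: F2_smult)
  finally show ?thesis by (simp add: poly_eval_superset[of ?S])
qed

lemma poly_eval_single: "poly_eval A b (Poly_Mapping.single m c) = c \<odot> monom_eval A b m"
  by (subst poly_eval_superset[of "{m}"]) (auto simp: F2_smult)

lemma poly_eval_mult: "poly_eval A b (p * q) = poly_eval A b p \<otimes> poly_eval A b q"
proof (induction p rule: massey_poly_additive_induct)
  case (single m c)
  show ?case
  proof (induction q rule: massey_poly_additive_induct)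
    case (single m' c')
    show ?case
      by (simp add: mult_single poly_eval_single monom_eval_add F2_smult_mult
          mult.commute[of c] F2_smult)
  qed (simp add: distrib_left poly_eval_add r_distr)
qed (simp add: distrib_right poly_eval_add l_distr)

lemma poly_eval_const: "poly_eval A b (massey_const c) = c \<odot> \<one>"
  unfolding massey_const_def poly_eval_single by (simp add: monom_eval_def)

lemma poly_eval_var: "poly_eval A b (massey_var i j) = b (i, j)"
  unfolding massey_var_def poly_eval_single by (simp add: monom_eval_def F2_smult b)

lemma poly_eval_sum:
  "finite S \<Longrightarrow> poly_eval A b (sum f S) = (\<Oplus>x\<in>S. poly_eval A b (f x))"
  by (induction S rule: finite_induct)
    (simp_all add: poly_eval_add poly_eval_def[of _ _ 0] flip: poly_eval_def)

text \<open>The polynomials at which evaluation commutes with the derivations are closed under sums, and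
  under products by the Leibniz rule on both sides. They include the constants, whose derivatives
  vanish, and by hypothesis the variables.\<close>

lemma poly_eval_diff:
  assumes d: "\<And>i j. (i, j) \<in> massey_index n \<Longrightarrow> diff A (b (i, j)) = massey_sum A b i j"
    and "p \<in> carrier (massey_alg n)"
  shows "poly_eval A b (massey_diff p) = diff A (poly_eval A b p)"
  using assms(2)
proof (induction p rule: massey_alg_induct)
  case (const c)
  show ?case
    using poly_eval_const[of 0]
    by (simp add: massey_diff_const poly_eval_const F2_smult diff_smult diff_one)
next
  case (var i j)
  then show ?case
    by (simp add: massey_diff_var poly_eval_sum poly_eval_mult poly_eval_var d massey_sum_def)
next
  case (add p q)
  then show ?case by (simp add: massey_diff_add poly_eval_add diff_add)
next
  case (mult p q)
  then show ?case by (simp add: massey_diff_mult poly_eval_add poly_eval_mult diff_mult)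
qed

lemma poly_eval_map:
  assumes "\<And>i j. (i, j) \<in> massey_index n \<Longrightarrow> diff A (b (i, j)) = massey_sum A b i j"
  shows "restrict (poly_eval A b) (carrier (massey_alg n)) \<in> diff_algebra_maps (massey_alg n) A"
  using poly_eval_const[of 1]
  by (auto simp: diff_algebra_maps_def ring_hom_def massey_carrier_mult massey_carrier_add
      massey_carrier_1 massey_carrier_const massey_carrier_diff poly_eval_mult poly_eval_add
      poly_eval_const poly_eval_diff[OF assms] F2_smult F2_smult_mult)

end

section \<open>Maps out of the universal algebra\<close>

lemma massey_map_simps:
  assumes f: "f \<in> diff_algebra_maps (massey_alg n) A"
  shows "p \<in> carrier (massey_alg n) \<Longrightarrow> f p \<in> carrier A"
    and "\<lbrakk>p \<in> carrier (massey_alg n); q \<in> carrier (massey_alg n)\<rbrakk> \<Longrightarrow> f (p + q) = f p \<oplus> f q"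
    and "\<lbrakk>p \<in> carrier (massey_alg n); q \<in> carrier (massey_alg n)\<rbrakk> \<Longrightarrow> f (p * q) = f p \<otimes> f q"
    and "f (massey_const c) = c \<odot> \<one>"
    and "p \<in> carrier (massey_alg n) \<Longrightarrow> f (massey_diff p) = diff A (f p)"
proof -
  show const: "f (massey_const c) = c \<odot> \<one>"
    using f massey_carrier_1[of n]
    by (auto simp: diff_algebra_maps_def ring_hom_def dest!: spec[of _ c] bspec[of _ _ 1])
qed (use f in \<open>auto simp: diff_algebra_maps_def ring_hom_def\<close>)

lemma massey_map_eqI:
  assumes f: "f \<in> diff_algebra_maps (massey_alg n) A"
    and g: "g \<in> diff_algebra_maps (massey_alg n) A"
    and eq: "\<And>i j. (i, j) \<in> massey_index n \<Longrightarrow> f (massey_var i j) = g (massey_var i j)"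
  shows "f = g"
proof (rule extensionalityI[of _ "carrier (massey_alg n)"])
  fix p assume "p \<in> carrier (massey_alg n)"
  then show "f p = g p"
    by (induction p rule: massey_alg_induct)
      (simp_all add: eq massey_map_simps[OF f] massey_map_simps[OF g])
qed (use f g in \<open>auto simp: diff_algebra_maps_def PiE_def\<close>)

lemma massey_map_sum:
  assumes f: "f \<in> diff_algebra_maps (massey_alg n) A"
    and "finite S" "\<And>x. x \<in> S \<Longrightarrow> h x \<in> carrier (massey_alg n)"
  shows "f (sum h S) = (\<Oplus>x\<in>S. f (h x))"
  using assms(2,3)
proof (induction S rule: finite_induct)
  case empty
  show ?case using massey_map_simps(4)[OF f, of 0] by (simp add: F2_smult)
next
  case (insert x S)
  then show ?case
    by (simp add: massey_map_simps[OF f] massey_carrier_sum)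
qed

text \<open>The differential of a variable is quadratic in the variables, which a map takes to the
  equations of a defining system together with the one for \<open>(0, n)\<close>.\<close>

lemma massey_map_diff_var:
  assumes f: "f \<in> diff_algebra_maps (massey_alg n) A" and ij: "(i, j) \<in> massey_index n"
  shows "diff A (f (massey_var i j)) = massey_sum A (\<lambda>(k, l). f (massey_var k l)) i j"
proof -
  have in_X: "massey_var i k \<in> carrier (massey_alg n)" "massey_var k j \<in> carrier (massey_alg n)"
    if "k \<in> {i<..<j}" for k
    using that ij by (auto intro!: massey_carrier_var simp: massey_index_def)
  have "diff A (f (massey_var i j)) = f (\<Sum>k\<in>{i<..<j}. massey_var i k * massey_var k j)"
    using massey_map_simps(5)[OF f massey_carrier_var[OF ij]] by (simp add: massey_diff_var)
  also have "\<dots> = (\<Oplus>k\<in>{i<..<j}. f (massey_var i k * massey_var k j))"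
    by (rule massey_map_sum[OF f]) (simp_all add: massey_carrier_mult in_X)
  also have "\<dots> = (\<Oplus>k\<in>{i<..<j}. f (massey_var i k) \<otimes> f (massey_var k j))"
    by (rule finsum_cong') (use in_X massey_map_simps[OF f] in auto)
  finally show ?thesis by (simp add: massey_sum_def)
qed

text \<open>The sum for \<open>(i, j)\<close> runs over strictly shorter intervals, so it never involves the entry at
  \<open>(0, n)\<close>. Hence a defining system and its extension by a bounding element have the same sums.\<close>

lemma massey_sum_cong:
  assumes "(i, j) \<in> massey_index n"
    and "\<And>v. v \<in> massey_index n - {(0, n)} \<Longrightarrow> a v = b v"
    and "\<And>v. v \<in> massey_index n - {(0, n)} \<Longrightarrow> b v \<in> carrier A"
  shows "massey_sum A a i j = massey_sum A b i j"
  unfolding massey_sum_def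
  by (rule finsum_cong') (use assms in \<open>auto simp: massey_index_def\<close>)

section \<open>Homology classes and induced maps\<close>

lemma homology_class_eq: "homology_class A z = (\<lambda>y. diff A y \<oplus> z) ` carrier A"
  by (auto simp: homology_class_def boundaries_def a_r_coset_def')

text \<open>Translation by \<open>x\<close> permutes the elements \<open>y\<close> in the family \<open>d y + z\<close> that
  makes up a class.\<close>

lemma homology_class_add_boundary:
  assumes x: "x \<in> carrier A" and z: "z \<in> carrier A"
  shows "homology_class A (diff A x \<oplus> z) = homology_class A z"
proof -
  have "diff A y \<oplus> (diff A x \<oplus> z) = diff A (y \<oplus> x) \<oplus> z" if "y \<in> carrier A" for y
    using that x z by (simp add: diff_add diff_closed a_assoc)
  then have "homology_class A (diff A x \<oplus> z) = (\<lambda>y. diff A y \<oplus> z) ` ((\<lambda>y. y \<oplus> x) ` carrier A)"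
    unfolding homology_class_eq image_image by (rule image_cong[OF refl])
  also have "(\<lambda>y. y \<oplus> x) ` carrier A = carrier A"
  proof
    show "carrier A \<subseteq> (\<lambda>y. y \<oplus> x) ` carrier A"
    proof
      fix y assume y: "y \<in> carrier A"
      then show "y \<in> (\<lambda>y. y \<oplus> x) ` carrier A"
        by (intro image_eqI[of _ _ "y \<oplus> \<ominus> x"]) (simp_all add: x a_assoc l_neg)
    qed
  qed (use x in auto)
  finally show ?thesis by (simp only: homology_class_eq)
qed

text \<open>A map takes boundaries to boundaries, so all representatives give the same class and the
  induced map can be computed on any one of them.\<close>

lemma induced_map_homology_class:
  assumes f: "f \<in> diff_algebra_maps (massey_alg n) A" and z: "z \<in> carrier (massey_alg n)"
  shows "induced_map (massey_alg n) A f (homology_class (massey_alg n) z) = homology_class A (f z)"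
proof -
  have "homology_class A (f (massey_diff x + z)) = homology_class A (f z)"
    if "x \<in> carrier (massey_alg n)" for x
    using that z by (simp add: massey_map_simps[OF f] massey_carrier_diff homology_class_add_boundary)
  then have "(\<lambda>w. homology_class A (f w)) ` homology_class (massey_alg n) z = {homology_class A (f z)}"
    using massey_carrier_0[of n]
    by (auto simp: comm_diff_algebra.homology_class_eq[OF massey_alg_comm_diff_algebra] image_image)
  then show ?thesis by (simp add: induced_map_def)
qed

lemma induced_map_massey_h:
  assumes f: "f \<in> diff_algebra_maps (massey_alg n) A" and i: "i \<in> {1..n}"
  shows "induced_map (massey_alg n) A f (massey_h n (i - 1)) = homology_class A (f (massey_var (i - 1) i))"
  using i induced_map_homology_class[OF f massey_carrier_var[of "i - 1" i]]
  by (simp add: massey_h_def massey_index_def)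

end

section \<open>Maps and decompositions of zero\<close>

theorem theorem2p10:
  fixes A :: "(bit, 'a) diff_algebra" and n :: nat and \<alpha> :: "nat \<Rightarrow> 'a set"
  assumes "comm_diff_algebra A"
    and "n \<ge> 2"
    and "\<And>i. i \<in> {1..n} \<Longrightarrow> \<alpha> i \<in> carrier (homology A)"
  shows "bij_betw
    (\<lambda>f. (\<lambda>(i, j)\<in>massey_index n - {(0, n)}. f (massey_var i j), f (massey_var 0 n)))
    {f \<in> diff_algebra_maps (massey_alg n) A.
       \<forall>i\<in>{1..n}. induced_map (massey_alg n) A f (massey_h n (i - 1)) = \<alpha> i}
    (zero_decompositions A n \<alpha>)"
proof -
  interpret comm_diff_algebra A by (rule assms(1))
  let ?I = "massey_index n" and ?J = "massey_index n - {(0, n)}"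
  let ?F = "{f \<in> diff_algebra_maps (massey_alg n) A.
       \<forall>i\<in>{1..n}. induced_map (massey_alg n) A f (massey_h n (i - 1)) = \<alpha> i}"
  let ?\<Phi> = "\<lambda>f. (\<lambda>(i, j)\<in>?J. f (massey_var i j), f (massey_var 0 n))"
  have top: "(0, n) \<in> ?I" using assms(2) by (simp add: massey_index_def)
  (* As n is at least 2, the entries that represent the given classes belong to the defining
     system and are not the bounding element. *)
  have diag: "(i - 1, i) \<in> ?J" if "i \<in> {1..n}" for i
    using that assms(2) by (auto simp: massey_index_def)
  have diag_sum: "massey_sum A a (i - 1) i = \<zero>\<^bsub>A\<^esub>" for a i
  proof -
    have "{i - 1<..<i} = {}" by auto
    then show ?thesis by (simp add: massey_sum_def)
  qed
  have inj: "inj_on ?\<Phi> ?F"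
  proof (rule inj_onI)
    fix f g assume f: "f \<in> ?F" and g: "g \<in> ?F" and eq: "?\<Phi> f = ?\<Phi> g"
    have "f (massey_var i j) = g (massey_var i j)" if "(i, j) \<in> ?I" for i j
    proof (cases "(i, j) = (0, n)")
      case False
      then have "(i, j) \<in> ?J" using that by simp
      then show ?thesis using fun_cong[OF arg_cong[OF eq, of fst], of "(i, j)"] by simp
    qed (use eq in simp)
    then show "f = g" using f g massey_map_eqI by blast
  qed
  have into: "?\<Phi> f \<in> zero_decompositions A n \<alpha>" if "f \<in> ?F" for f
  proof -
    let ?a = "\<lambda>(i, j)\<in>?J. f (massey_var i j)" and ?b = "\<lambda>(i, j). f (massey_var i j)"
    have f: "f \<in> diff_algebra_maps (massey_alg n) A" using that by simp
    have b: "?b v \<in> carrier A" if "v \<in> ?I" for v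
      using that massey_map_simps(1)[OF f] massey_carrier_var by (cases v) auto
    have sum: "massey_sum A ?a i j = diff A (f (massey_var i j))" if "(i, j) \<in> ?I" for i j
    proof -
      have "massey_sum A ?a i j = massey_sum A ?b i j"
        by (rule massey_sum_cong[OF that]) (use b in auto)
      then show ?thesis using massey_map_diff_var[OF f that] by simp
    qed
    have "?a \<in> defining_systems A n \<alpha>"
      unfolding defining_systems_def
    proof (intro CollectI conjI ballI)
      show "?a \<in> ?J \<rightarrow>\<^sub>E carrier A" using b by auto
    next
      fix i assume i: "i \<in> {1..n}"
      have a: "?a (i - 1, i) = f (massey_var (i - 1) i)" using diag[OF i] by simp
      show "?a (i - 1, i) \<in> cycles A"
        using b[of "(i - 1, i)"] diag[OF i] sum[of "i - 1" i] diag_sum[of ?a i] a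
        by (simp add: cycles_def)
      show "homology_class A (?a (i - 1, i)) = \<alpha> i"
        using that i induced_map_massey_h[OF f i] a by simp
    qed (use sum in auto)
    then show ?thesis
      using b[OF top] sum[OF top] by (simp add: zero_decompositions_def)
  qed
  have onto: "\<exists>f\<in>?F. ?\<Phi> f = (a, c)" if "(a, c) \<in> zero_decompositions A n \<alpha>" for a c
  proof -
    have a: "a \<in> ?J \<rightarrow>\<^sub>E carrier A"
      and cls: "\<And>i. i \<in> {1..n} \<Longrightarrow> homology_class A (a (i - 1, i)) = \<alpha> i"
      and da: "\<And>i j. (i, j) \<in> ?J \<Longrightarrow> diff A (a (i, j)) = massey_sum A a i j"
      and c: "c \<in> carrier A" "diff A c = massey_sum A a 0 n"
      using that by (auto simp: zero_decompositions_def defining_systems_def)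
    (* The value outside the index set is arbitrary in the carrier. *)
    define b where "b v = (if v = (0, n) then c else if v \<in> ?J then a v else \<zero>\<^bsub>A\<^esub>)" for v
    have b: "b v \<in> carrier A" for v
      using a c by (auto simp: b_def)
    have sum: "massey_sum A b i j = massey_sum A a i j" if "(i, j) \<in> ?I" for i j
      by (rule massey_sum_cong[OF that]) (use a in \<open>auto simp: b_def\<close>)
    have db: "diff A (b (i, j)) = massey_sum A b i j" if "(i, j) \<in> ?I" for i j
      using that sum[OF that] da[of i j] c by (auto simp: b_def)
    define f where "f = restrict (poly_eval A b) (carrier (massey_alg n))"
    have f: "f \<in> diff_algebra_maps (massey_alg n) A"
      unfolding f_def using b db by (rule poly_eval_map)
    have var: "f (massey_var i j) = b (i, j)" if "(i, j) \<in> ?I" for i j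
      using that b by (simp add: f_def massey_carrier_var poly_eval_var)
    have "induced_map (massey_alg n) A f (massey_h n (i - 1)) = \<alpha> i" if i: "i \<in> {1..n}" for i
    proof -
      have "f (massey_var (i - 1) i) = a (i - 1, i)"
        using diag[OF i] var[of "i - 1" i] by (auto simp: b_def)
      then show ?thesis using induced_map_massey_h[OF f i] cls[OF i] by simp
    qed
    with f have "f \<in> ?F" by simp
    moreover have "(\<lambda>(i, j)\<in>?J. f (massey_var i j)) = a"
    proof (rule extensionalityI[of _ ?J])
      fix v assume "v \<in> ?J"
      then show "(\<lambda>(i, j)\<in>?J. f (massey_var i j)) v = a v"
        using var[of "fst v" "snd v"] by (cases v) (auto simp: b_def)
    qed (use a in \<open>simp_all add: PiE_def\<close>)
    then have "?\<Phi> f = (a, c)"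
      using var[OF top] by (simp add: b_def)
    ultimately show ?thesis by blast
  qed
  have "?\<Phi> ` ?F = zero_decompositions A n \<alpha>"
  proof
    show "zero_decompositions A n \<alpha> \<subseteq> ?\<Phi> ` ?F"
    proof
      fix x assume x: "x \<in> zero_decompositions A n \<alpha>"
      obtain a c where "x = (a, c)" by (cases x)
      then show "x \<in> ?\<Phi> ` ?F" using onto[of a c] x by (metis (no_types, lifting) image_eqI)
    qed
  qed (use into in blast)
  with inj show ?thesis by (simp add: bij_betw_def)
qed

end
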